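(* Let $\mathcal{H}$ be a real finite-dimensional Hilbert space with inner product $(\cdot,\cdot)$, let $A$ be a self-adjoint positive definite linear operator on $\mathcal{H}$, and let $\bar{B}_1, B_0, B_1$ be linear operators on $\mathcal{H}$. Let the linear operator $B$ on $\mathcal{H}$ be defined implicitly by $$I - BA = (I - \bar{B}_1 A)(I - B_0 A)(I - B_1 A).$$ Suppose that 1. $\bar{B}_1 = B_1^T$; 2. $B_0 = B_0^T$; 3. $\| I - B_1 A \|_A < 1$; 4. $B_0$ is non-negative on $\mathcal{H}$. Then $B$ is self-adjoint and positive definite with respect to $(\cdot,\cdot)$.
   Context: $M^T$ denotes the adjoint of $M$ with respect to $(\cdot,\cdot)$. An operator $M$ is positive definite (positive) if $(Mu,u)>0$ for all $u\neq 0$, and non-negative if $(Mu,u)\ge 0$ for all $u$. For $A$ self-adjoint positive definite, $(u,v)_A=(Au,v)$ is an inner product with norm $\|u\|_A=(u,u)_A^{1/2}$; $\|M\|_A$ denotes the operator norm of $M$ induced by $\|\cdot\|_A$. $I$ is the identity operator. Since $A$ is invertible, the displayed equation determines $B$ uniquely. *)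

theory Defs
  imports "HOL-Analysis.Analysis"
begin

definition finite_dim_space :: "'a::real_vector itself \<Rightarrow> bool" where
  "finite_dim_space _ \<longleftrightarrow> (\<exists>S :: 'a set. finite S \<and> span S = UNIV)"

text \<open>The library constant \<^const>\<open>adjoint\<close> is a choice of an operator
  that is adjoint to the given one, so it is meaningful only where such an operator exists. On a
  finite-dimensional space every linear operator has exactly one. Unlike the class
  \<open>euclidean_space\<close>, the class \<open>real_inner\<close> with \<open>finite_dim_space\<close>
  admits the zero space.\<close>

definition self_adjoint :: "('a::real_inner \<Rightarrow> 'a) \<Rightarrow> bool" where
  "self_adjoint M \<longleftrightarrow> adjoint M = M"

definition positive_definite :: "('a::real_inner \<Rightarrow> 'a) \<Rightarrow> bool" where
  "positive_definite M \<longleftrightarrow> (\<forall>u. u \<noteq> 0 \<longrightarrow> M u \<bullet> u > 0)"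

definition non_negative :: "('a::real_inner \<Rightarrow> 'a) \<Rightarrow> bool" where
  "non_negative M \<longleftrightarrow> (\<forall>u. M u \<bullet> u \<ge> 0)"

definition inner_wrt :: "('a::real_inner \<Rightarrow> 'a) \<Rightarrow> 'a \<Rightarrow> 'a \<Rightarrow> real" where
  "inner_wrt A u v = A u \<bullet> v"

definition norm_wrt :: "('a::real_inner \<Rightarrow> 'a) \<Rightarrow> 'a \<Rightarrow> real" where
  "norm_wrt A u = sqrt (inner_wrt A u u)"

text \<open>Same shape as \<^const>\<open>onorm\<close>: the vector \<open>u = 0\<close> contributes
  \<open>0 / 0 = 0\<close>, which leaves the supremum unchanged and makes it \<open>0\<close> on the
  zero space. For linear \<open>M\<close> and self-adjoint positive definite \<open>A\<close> in
  finite dimension, the quotients are bounded above.\<close>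

definition onorm_wrt :: "('a::real_inner \<Rightarrow> 'a) \<Rightarrow> ('a \<Rightarrow> 'a) \<Rightarrow> real" where
  "onorm_wrt A M = (SUP u. norm_wrt A (M u) / norm_wrt A u)"

end

theory Submission imports Defs begin

text \<open>Write \<open>K = I - B\<^sub>1 A\<close>. Since \<open>A\<close> is self-adjoint, \<open>I - B\<^sub>1\<^sup>T A\<close> is the
  adjoint of \<open>K\<close> for the inner product \<open>(u, v)\<^sub>A = (A u, v)\<close>, so
  the error propagator satisfies
  \<open>((I - B A) u, v)\<^sub>A = ((I - B\<^sub>0 A) K u, K v)\<^sub>A\<close> (\<open>symmetrized_product_form\<close>).
  The right-hand side is symmetric in \<open>u\<close> and \<open>v\<close> because \<open>B\<^sub>0\<close> is self-adjoint, hence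
  so is \<open>(B A u, A v)\<close>. On the diagonal the same identity reads
  \<open>(B A u, A u) = \<parallel>u\<parallel>\<^sub>A\<^sup>2 - \<parallel>K u\<parallel>\<^sub>A\<^sup>2 + (B\<^sub>0 A K u, A K u)\<close>,
  where the last term is non-negative and the difference before it is positive for
  \<open>u \<noteq> 0\<close> because \<open>K\<close> contracts the \<open>A\<close>-norm strictly. As \<open>A\<close> is
  surjective (\<open>positive_definite_surj\<close>), \<open>A u\<close> and \<open>A v\<close> range over the whole space,
  and both conclusions follow.

  The finite dimension enters three times: adjoints exist, a positive definite operator
  is surjective, and the \<open>A\<close>-norm is equivalent to the given norm. The last point makes
  the supremum \<open>onorm_wrt\<close> one of a bounded set, so that it really bounds each quotient. All
  three are obtained from a finite orthogonal spanning set, which covers the zero space as well.\<close>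

section \<open>Orthogonal expansions in finite dimension\<close>

text \<open>The zero vector may belong to \<open>C\<close>. Its coefficient \<open>0 / 0\<close> is harmless, as its
  contribution vanishes in any case.\<close>

lemma orthogonal_projection_residual:
  fixes x y :: "'a::real_inner"
  assumes "finite C" "pairwise orthogonal C" "y \<in> span C"
  shows "(x - (\<Sum>c\<in>C. (x \<bullet> c / (c \<bullet> c)) *\<^sub>R c)) \<bullet> y = 0"
proof -
  let ?z = "x - (\<Sum>c\<in>C. (x \<bullet> c / (c \<bullet> c)) *\<^sub>R c)"
  have "orthogonal ?z d" if d: "d \<in> C" for d
  proof -
    have off_diagonal: "(x \<bullet> c / (c \<bullet> c)) * (c \<bullet> d) = (if c = d then x \<bullet> d else 0)"
      if "c \<in> C" for c
      using that d assms(2) by (auto simp: pairwise_def orthogonal_def)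
    have "(\<Sum>c\<in>C. (x \<bullet> c / (c \<bullet> c)) *\<^sub>R c) \<bullet> d
        = (\<Sum>c\<in>C. (x \<bullet> c / (c \<bullet> c)) * (c \<bullet> d))"
      by (simp add: inner_sum_left)
    also have "\<dots> = (\<Sum>c\<in>C. if c = d then x \<bullet> d else 0)"
      by (rule sum.cong) (simp_all only: off_diagonal)
    also have "\<dots> = x \<bullet> d"
      using assms(1) d by simp
    finally show ?thesis
      by (simp add: orthogonal_def inner_diff_left)
  qed
  then have "orthogonal ?z y"
    using orthogonal_to_span[OF assms(3)] by blast
  then show ?thesis
    by (simp add: orthogonal_def)
qed

lemma orthogonal_expansion:
  assumes "finite_dim_space TYPE('a::real_inner)"
  obtains C :: "'a::real_inner set" where "finite C"
    and "\<And>x. x = (\<Sum>c\<in>C. (x \<bullet> c / (c \<bullet> c)) *\<^sub>R c)"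
proof -
  obtain S :: "'a set" where "finite S" "span S = UNIV"
    using assms by (auto simp: finite_dim_space_def)
  then obtain C :: "'a set" where C: "finite C" "span C = UNIV" "pairwise orthogonal C"
    using basis_orthogonal[of S] by auto
  have "x = (\<Sum>c\<in>C. (x \<bullet> c / (c \<bullet> c)) *\<^sub>R c)" for x
  proof -
    let ?z = "x - (\<Sum>c\<in>C. (x \<bullet> c / (c \<bullet> c)) *\<^sub>R c)"
    have "?z \<bullet> ?z = 0"
      by (rule orthogonal_projection_residual[OF C(1,3)]) (simp add: C(2))
    then show ?thesis
      by (simp only: inner_eq_zero_iff right_minus_eq)
  qed
  with C(1) show ?thesis
    by (rule that)
qed

lemma linear_orthogonal_expansion:
  assumes "linear f" and "x = (\<Sum>c\<in>C. (x \<bullet> c / (c \<bullet> c)) *\<^sub>R c)"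
  shows "f x = (\<Sum>c\<in>C. (x \<bullet> c / (c \<bullet> c)) *\<^sub>R f c)"
proof -
  have "f x = f (\<Sum>c\<in>C. (x \<bullet> c / (c \<bullet> c)) *\<^sub>R c)"
    by (rule arg_cong[where f = f, OF assms(2)])
  also have "\<dots> = (\<Sum>c\<in>C. (x \<bullet> c / (c \<bullet> c)) *\<^sub>R f c)"
    by (simp add: linear_sum[OF assms(1)] linear_scale[OF assms(1)])
  finally show ?thesis .
qed

lemma finite_dim_linear_bounded:
  fixes f :: "'a::real_inner \<Rightarrow> 'a"
  assumes "finite_dim_space TYPE('a)" and f: "linear f"
  obtains k where "k > 0" and "\<And>x. norm (f x) \<le> k * norm x"
proof -
  obtain C :: "'a set" where C: "finite C"
    and expansion: "\<And>x. x = (\<Sum>c\<in>C. (x \<bullet> c / (c \<bullet> c)) *\<^sub>R c)"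
    using orthogonal_expansion[OF assms(1)] by blast
  let ?k = "\<Sum>c\<in>C. norm c / (c \<bullet> c) * norm (f c)"
  have "norm (f x) \<le> (?k + 1) * norm x" for x
  proof -
    have "norm (f x) \<le> (\<Sum>c\<in>C. norm ((x \<bullet> c / (c \<bullet> c)) *\<^sub>R f c))"
      by (subst linear_orthogonal_expansion[OF f expansion]) (rule norm_sum)
    also have "\<dots> \<le> (\<Sum>c\<in>C. norm c / (c \<bullet> c) * norm (f c) * norm x)"
    proof (rule sum_mono)
      fix c
      have "\<bar>x \<bullet> c\<bar> / (c \<bullet> c) * norm (f c) \<le> norm x * norm c / (c \<bullet> c) * norm (f c)"
        by (intro mult_right_mono divide_right_mono Cauchy_Schwarz_ineq2) auto
      then show "norm ((x \<bullet> c / (c \<bullet> c)) *\<^sub>R f c) \<le> norm c / (c \<bullet> c) * norm (f c) * norm x"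
        by (simp add: mult_ac)
    qed
    also have "\<dots> = ?k * norm x"
      by (simp add: sum_distrib_right)
    also have "\<dots> \<le> (?k + 1) * norm x"
      by (intro mult_right_mono) auto
    finally show ?thesis .
  qed
  moreover have "?k + 1 > 0"
    by (intro add_nonneg_pos sum_nonneg) auto
  ultimately show ?thesis
    using that by blast
qed

text \<open>The choice in \<^const>\<open>adjoint\<close> is justified by the explicit adjoint
  \<open>y \<mapsto> \<Sum>c\<in>C. ((f c, y) / (c, c)) c\<close>.\<close>

lemma finite_dim_adjoint_works:
  fixes f :: "'a::real_inner \<Rightarrow> 'a"
  assumes "finite_dim_space TYPE('a)" and "linear f"
  shows "f x \<bullet> y = x \<bullet> adjoint f y"
proof -
  obtain C :: "'a set" where
    expansion: "\<And>x. x = (\<Sum>c\<in>C. (x \<bullet> c / (c \<bullet> c)) *\<^sub>R c)"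
    using orthogonal_expansion[OF assms(1)] by blast
  let ?g = "\<lambda>y. \<Sum>c\<in>C. (f c \<bullet> y / (c \<bullet> c)) *\<^sub>R c"
  have adj: "f x \<bullet> y = x \<bullet> ?g y" for x y
  proof -
    have "f x \<bullet> y = (\<Sum>c\<in>C. (x \<bullet> c / (c \<bullet> c)) *\<^sub>R f c) \<bullet> y"
      by (rule arg_cong[where f = "\<lambda>z. z \<bullet> y", OF linear_orthogonal_expansion[OF assms(2), OF expansion]])
    also have "\<dots> = x \<bullet> ?g y"
      by (simp add: inner_sum_left inner_sum_right mult_ac)
    finally show ?thesis .
  qed
  have adjoint_eq: "adjoint f = ?g"
    by (rule adjoint_unique) (intro allI adj)
  show ?thesis
    unfolding adjoint_eq by (rule adj)
qed

section \<open>Positive definite operators and the energy norm\<close>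

text \<open>A vector orthogonal to the range of \<open>A\<close> satisfies \<open>(A z, z) = 0\<close>, hence is zero.\<close>

lemma positive_definite_surj:
  fixes A :: "'a::real_inner \<Rightarrow> 'a"
  assumes "finite_dim_space TYPE('a)" and A: "linear A" and pd: "positive_definite A"
  shows "surj A"
proof -
  obtain S :: "'a set" where S: "finite S" "span S = UNIV"
    using assms(1) by (auto simp: finite_dim_space_def)
  then obtain C where C: "finite C" "span C = span (A ` S)" "pairwise orthogonal C"
    using basis_orthogonal[of "A ` S"] by auto
  have range: "span C = range A"
    using linear_span_image[OF A, of S] S(2) C(2) by simp
  have zero: "z = 0" if "z \<bullet> A z = 0" for z
    using pd that unfolding positive_definite_def by (metis inner_commute less_irrefl)
  have "x \<in> range A" for x
  proof -
    let ?p = "\<Sum>c\<in>C. (x \<bullet> c / (c \<bullet> c)) *\<^sub>R c"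
    have "(x - ?p) \<bullet> A (x - ?p) = 0"
      by (rule orthogonal_projection_residual[OF C(1,3)]) (simp add: range)
    then have "x - ?p = 0"
      by (rule zero)
    moreover have "?p \<in> span C"
      by (intro span_sum span_scale span_base)
    ultimately show ?thesis
      using range by simp
  qed
  then show ?thesis
    by blast
qed

lemma positive_definite_imp_nonneg:
  assumes "positive_definite A" and "linear A"
  shows "A u \<bullet> u \<ge> 0"
  using assms by (cases "u = 0") (auto simp: positive_definite_def linear_0 less_imp_le)

lemma norm_wrt_pos:
  assumes "positive_definite A" and "u \<noteq> 0"
  shows "norm_wrt A u > 0"
  using assms by (simp add: norm_wrt_def inner_wrt_def positive_definite_def)

lemma self_adjoint_inner_commute:
  fixes A :: "'a::real_inner \<Rightarrow> 'a"
  assumes "finite_dim_space TYPE('a)" and "linear A" and "self_adjoint A"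
  shows "A u \<bullet> v = u \<bullet> A v"
  using finite_dim_adjoint_works[OF assms(1,2)] assms(3) by (simp add: self_adjoint_def)

text \<open>Coercivity without compactness or eigenvalues: \<open>A w = u\<close> has a solution of
  size at most \<open>k \<parallel>u\<parallel>\<close>. Expanding the non-negative number \<open>(A (w - t u), w - t u)\<close> gives
  \<open>(u, w) - 2 t \<parallel>u\<parallel>\<^sup>2 + t\<^sup>2 (A u, u)\<close>, and \<open>t = k\<close> is the choice for which the first two
  terms add up to at most \<open>- k \<parallel>u\<parallel>\<^sup>2\<close>.\<close>

lemma positive_definite_coercive:
  fixes A :: "'a::real_inner \<Rightarrow> 'a"
  assumes fd: "finite_dim_space TYPE('a)" and A: "linear A"
    and sa: "self_adjoint A" and pd: "positive_definite A"
  obtains k where "k > 0" and "\<And>u. (norm u)\<^sup>2 \<le> k * (A u \<bullet> u)"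
proof -
  have "inj A"
  proof (rule linear_injective_0[OF A, THEN iffD2], intro allI impI)
    fix x assume "A x = 0"
    then show "x = 0"
      using pd by (metis inner_zero_left less_irrefl positive_definite_def)
  qed
  then obtain G where G: "linear G" and "G \<circ> A = id"
    using linear_injective_left_inverse[OF A] by blast
  then have AG: "A (G u) = u" for u
    using positive_definite_surj[OF fd A pd] by (metis comp_apply id_apply surjD)
  obtain k where k: "k > 0" and bound: "\<And>u. norm (G u) \<le> k * norm u"
    using finite_dim_linear_bounded[OF fd G] by blast
  have "(norm u)\<^sup>2 \<le> k * (A u \<bullet> u)" for u
  proof -
    have "0 \<le> A (G u - k *\<^sub>R u) \<bullet> (G u - k *\<^sub>R u)"
      by (rule positive_definite_imp_nonneg[OF pd A])
    also have "\<dots> = u \<bullet> G u - k * (u \<bullet> u) - k * (A u \<bullet> G u) + k * (k * (A u \<bullet> u))"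
      by (simp add: linear_diff[OF A] linear_scale[OF A] AG inner_diff_left inner_diff_right
          algebra_simps)
    also have "A u \<bullet> G u = u \<bullet> u"
      using self_adjoint_inner_commute[OF fd A sa, of u "G u"] by (simp add: AG)
    finally have "2 * (k * (norm u)\<^sup>2) \<le> u \<bullet> G u + k * (k * (A u \<bullet> u))"
      by (simp add: power2_norm_eq_inner)
    moreover have "u \<bullet> G u \<le> k * (norm u)\<^sup>2"
    proof -
      have "u \<bullet> G u \<le> norm u * norm (G u)"
        by (rule norm_cauchy_schwarz)
      also have "\<dots> \<le> norm u * (k * norm u)"
        by (intro mult_left_mono bound) auto
      finally show ?thesis
        by (simp add: power2_eq_square mult_ac)
    qed
    ultimately have "k * (norm u)\<^sup>2 \<le> k * (k * (A u \<bullet> u))"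
      by linarith
    then show ?thesis
      using k by simp
  qed
  with k show ?thesis
    by (rule that)
qed

text \<open>A conditionally complete supremum says nothing about its members unless the set is
  bounded above; the equivalence of norms supplies the bound.\<close>

lemma norm_wrt_le_onorm_wrt:
  fixes A M :: "'a::real_inner \<Rightarrow> 'a"
  assumes fd: "finite_dim_space TYPE('a)" and A: "linear A"
    and sa: "self_adjoint A" and pd: "positive_definite A" and M: "linear M"
  shows "norm_wrt A (M u) / norm_wrt A u \<le> onorm_wrt A M"
proof -
  obtain k where k: "k > 0" "\<And>u. (norm u)\<^sup>2 \<le> k * (A u \<bullet> u)"
    using positive_definite_coercive[OF fd A sa pd] by blast
  obtain a where a: "a > 0" "\<And>x. norm (A x) \<le> a * norm x"
    using finite_dim_linear_bounded[OF fd A] by blast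
  obtain m where m: "m > 0" "\<And>x. norm (M x) \<le> m * norm x"
    using finite_dim_linear_bounded[OF fd M] by blast
  have bound: "A (M v) \<bullet> M v \<le> a * m\<^sup>2 * k * (A v \<bullet> v)" for v
  proof -
    have "A (M v) \<bullet> M v \<le> norm (A (M v)) * norm (M v)"
      by (rule norm_cauchy_schwarz)
    also have "\<dots> \<le> (a * norm (M v)) * norm (M v)"
      by (intro mult_right_mono a) auto
    also have "\<dots> = a * (norm (M v))\<^sup>2"
      by (simp add: power2_eq_square)
    also have "\<dots> \<le> a * (m * norm v)\<^sup>2"
      using a(1) m(2) by (intro mult_left_mono power_mono) auto
    also have "\<dots> = a * m\<^sup>2 * (norm v)\<^sup>2"
      by (simp add: power_mult_distrib)
    also have "\<dots> \<le> a * m\<^sup>2 * (k * (A v \<bullet> v))"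
      using a(1) k(2) by (intro mult_left_mono) auto
    finally show ?thesis
      by (simp add: mult_ac)
  qed
  have "norm_wrt A (M v) / norm_wrt A v \<le> sqrt (a * m\<^sup>2 * k)" for v
  proof (cases "v = 0")
    case True
    then show ?thesis
      using a k by (simp add: norm_wrt_def inner_wrt_def)
  next
    case False
    have "norm_wrt A (M v) \<le> sqrt (a * m\<^sup>2 * k) * norm_wrt A v"
      unfolding norm_wrt_def inner_wrt_def real_sqrt_mult[symmetric]
      by (rule real_sqrt_le_mono) (rule bound)
    then show ?thesis
      using norm_wrt_pos[OF pd False] by (simp add: divide_le_eq)
  qed
  then have "bdd_above (range (\<lambda>v. norm_wrt A (M v) / norm_wrt A v))"
    by (intro bdd_aboveI2)
  then show ?thesis
    unfolding onorm_wrt_def by (rule cSUP_upper2[OF _ UNIV_I order_refl])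
qed

lemma energy_contraction:
  fixes A M :: "'a::real_inner \<Rightarrow> 'a"
  assumes "finite_dim_space TYPE('a)" and A: "linear A"
    and "self_adjoint A" and pd: "positive_definite A" and "linear M"
    and contr: "onorm_wrt A M < 1" and u: "u \<noteq> 0"
  shows "A (M u) \<bullet> M u < A u \<bullet> u"
proof -
  have "norm_wrt A (M u) / norm_wrt A u < 1"
    using norm_wrt_le_onorm_wrt[OF assms(1-5)] contr by (rule le_less_trans)
  then have "norm_wrt A (M u) < norm_wrt A u"
    using norm_wrt_pos[OF pd u] by (simp add: divide_less_eq)
  then show ?thesis
    by (simp add: norm_wrt_def inner_wrt_def)
qed

section \<open>The symmetrized product\<close>

text \<open>For the energy inner product, \<open>I - S A\<close> is the adjoint of \<open>I - T A\<close>, so the leftmost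
  factor can be moved to the other argument; what remains is expanded around \<open>I - R A\<close>.\<close>

lemma symmetrized_product_form:
  fixes A S R T B :: "'a::real_inner \<Rightarrow> 'a"
  assumes A: "linear A" and symA: "\<And>u v. A u \<bullet> v = u \<bullet> A v"
    and adj: "\<And>x y. T x \<bullet> y = x \<bullet> S y"
    and product: "(\<lambda>u. u - B (A u)) = (\<lambda>u. u - S (A u)) \<circ> (\<lambda>u. u - R (A u)) \<circ> (\<lambda>u. u - T (A u))"
  shows "B (A u) \<bullet> A v = A u \<bullet> v - A (u - T (A u)) \<bullet> (v - T (A v))
    + R (A (u - T (A u))) \<bullet> A (v - T (A v))"
proof -
  define K where "K = (\<lambda>u. u - T (A u))"
  have transfer: "A (w - S (A w)) \<bullet> v = A w \<bullet> K v" for w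
    by (simp add: K_def linear_diff[OF A] inner_diff_left inner_diff_right symA[of "S (A w)"])
      (metis adj inner_commute)
  have "A u \<bullet> v - B (A u) \<bullet> A v = A (u - B (A u)) \<bullet> v"
    by (simp add: linear_diff[OF A] inner_diff_left symA[of "B (A u)"])
  also have "u - B (A u) = (K u - R (A (K u))) - S (A (K u - R (A (K u))))"
    using fun_cong[OF product, of u] by (simp only: K_def o_def)
  also have "A \<dots> \<bullet> v = A (K u - R (A (K u))) \<bullet> K v"
    by (rule transfer)
  also have "\<dots> = A (K u) \<bullet> K v - R (A (K u)) \<bullet> A (K v)"
    by (simp add: linear_diff[OF A] inner_diff_left symA[of "R (A (K u))"])
  finally show ?thesis
    by (simp add: K_def)
qed

theorem lemma3p1:
  fixes A B1bar B0 B1 B :: "'a::real_inner \<Rightarrow> 'a"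
  assumes "finite_dim_space TYPE('a)"
    and "linear A" and "self_adjoint A" and "positive_definite A"
    and "linear B1bar" and "linear B0" and "linear B1" and "linear B"
    and "(\<lambda>u. u - B (A u)) =
      (\<lambda>u. u - B1bar (A u)) \<circ> (\<lambda>u. u - B0 (A u)) \<circ> (\<lambda>u. u - B1 (A u))"
    and "B1bar = adjoint B1"
    and "B0 = adjoint B0"
    and "onorm_wrt A (\<lambda>u. u - B1 (A u)) < 1"
    and "non_negative B0"
  shows "self_adjoint B \<and> positive_definite B"
proof -
  note fd = assms(1) and A = assms(2) and sa = assms(3) and pd = assms(4)
  let ?K = "\<lambda>u. u - B1 (A u)"
  have symA: "A u \<bullet> v = u \<bullet> A v" for u v
    by (rule self_adjoint_inner_commute[OF fd A sa])
  have symB0: "B0 x \<bullet> y = x \<bullet> B0 y" for x y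
    using finite_dim_adjoint_works[OF fd assms(6)] assms(11) by metis
  have adjB1: "B1 x \<bullet> y = x \<bullet> B1bar y" for x y
    using finite_dim_adjoint_works[OF fd assms(7)] assms(10) by simp
  have form: "B (A u) \<bullet> A v = A u \<bullet> v - A (?K u) \<bullet> ?K v + B0 (A (?K u)) \<bullet> A (?K v)" for u v
    by (rule symmetrized_product_form[OF A symA adjB1 assms(9)])
  have symBA: "B (A u) \<bullet> A v = A u \<bullet> B (A v)" for u v
  proof -
    have "B (A u) \<bullet> A v = B (A v) \<bullet> A u"
      unfolding form by (metis symA symB0 inner_commute)
    then show ?thesis
      by (simp add: inner_commute)
  qed
  have surj: "surj A"
    by (rule positive_definite_surj[OF fd A pd])
  have "B x \<bullet> y = x \<bullet> B y" for x y
    using symBA surj by (metis surjD)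
  then have "self_adjoint B"
    unfolding self_adjoint_def by (intro adjoint_unique) blast
  moreover have "B x \<bullet> x > 0" if "x \<noteq> 0" for x
  proof -
    obtain u where x: "x = A u"
      using surj by (rule surjE)
    then have u: "u \<noteq> 0"
      using that linear_0[OF A] by auto
    have K: "linear ?K"
      using linear_compose_sub[OF linear_id linear_compose[OF A assms(7)]]
      by (simp add: o_def id_def)
    have "A (?K u) \<bullet> ?K u < A u \<bullet> u"
      by (rule energy_contraction[OF fd A sa pd K assms(12) u])
    moreover have "B0 (A (?K u)) \<bullet> A (?K u) \<ge> 0"
      using assms(13) by (simp add: non_negative_def)
    ultimately show ?thesis
      unfolding x form by linarith
  qed
  ultimately show ?thesis
    by (simp add: positive_definite_def)
qed

end
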